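(* Let $\Gamma$ be a finite simplicial graph and let $A_\Gamma$ be the right-angled Artin group defined by $\Gamma$, equipped with its standard generating set $X=V(\Gamma)$. Then $\mathrm{UConjGeo}_X(A_\Gamma)$ is a piecewise testable language (over the alphabet $\tilde X=X\cup X^{-1}$).
   Context: $A_\Gamma$ is the group generated by the vertices of $\Gamma$ subject to the relations $xy=yx$ for every pair of adjacent vertices $x,y$. $\tilde X=X\cup X^{-1}$, $\tilde X^*$ is the free monoid on $\tilde X$, $\ell(w)$ is the length of a word $w$, and $\pi\colon\tilde X^*\to G$ is the canonical surjective homomorphism onto the group $G$ generated by $X$ (here $G=A_\Gamma$). A word $w\in\tilde X^*$ is a geodesic if $\ell(w)\le\ell(u)$ for every $u\in\tilde X^*$ with $u\pi=w\pi$; $\mathrm{Geo}_X(G)$ is the set of all geodesics. $\mathrm{UConj}$ is the equivalence relation on $G$ defined by: $(g,h)\in\mathrm{UConj}$ iff $g=h$, or both $g$ and $h$ have a conjugacy class with more than one element (i.e. both are noncentral). $\mathrm{UConjGeo}_X(G)=\{w\in\mathrm{Geo}_X(G):\ell(w)\le\ell(u)\text{ for all }u\in\mathrm{Geo}_X(G)\text{ with }(w\pi,u\pi)\in\mathrm{UConj}\}$. A language over a finite alphabet $A$ is piecewise testable if it is a finite Boolean combination of languages of the form $A^*a_1A^*\cdots A^*a_kA^*$ with $a_1,\dots,a_k\in A$. *)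

theory Defs
  imports "HOL-Algebra.Group_Action" "Graph_Theory.Pair_Digraph"
begin

section \<open>Words in generators and formal inverses\<close>

text \<open>The letter \<open>(x, True)\<close> stands for \<open>x\<close> and \<open>(x, False)\<close> for its formal inverse; the free
  monoid on the alphabet \<open>letters X\<close> is \<open>lists (letters X)\<close>.\<close>

type_synonym 'x letter = "'x \<times> bool"
type_synonym 'x word = "'x letter list"

definition letters :: "'x set \<Rightarrow> 'x letter set" where
  "letters X = X \<times> UNIV"

text \<open>The generators of a group \<open>G\<close> are given as a family \<open>\<iota> :: 'x \<Rightarrow> 'g\<close> indexed by \<open>X\<close>;
  \<open>word_eval G \<iota>\<close> is the canonical homomorphism from words to \<open>G\<close>.\<close>

definition letter_eval :: "('g, 'm) monoid_scheme \<Rightarrow> ('x \<Rightarrow> 'g) \<Rightarrow> 'x letter \<Rightarrow> 'g" where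
  "letter_eval G \<iota> a = (if snd a then \<iota> (fst a) else inv\<^bsub>G\<^esub> (\<iota> (fst a)))"

fun word_eval :: "('g, 'm) monoid_scheme \<Rightarrow> ('x \<Rightarrow> 'g) \<Rightarrow> 'x word \<Rightarrow> 'g" where
  "word_eval G \<iota> [] = \<one>\<^bsub>G\<^esub>"
| "word_eval G \<iota> (a # w) = letter_eval G \<iota> a \<otimes>\<^bsub>G\<^esub> word_eval G \<iota> w"


section \<open>Geodesics and UConj-geodesics\<close>

definition Geo :: "('g, 'm) monoid_scheme \<Rightarrow> ('x \<Rightarrow> 'g) \<Rightarrow> 'x set \<Rightarrow> 'x word set" where
  "Geo G \<iota> X = {w \<in> lists (letters X).
     \<forall>u \<in> lists (letters X). word_eval G \<iota> u = word_eval G \<iota> w \<longrightarrow> length w \<le> length u}"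

definition conjugacy_class :: "('g, 'm) monoid_scheme \<Rightarrow> 'g \<Rightarrow> 'g set" where
  "conjugacy_class G g = orbit G (\<lambda>k. \<lambda>h \<in> carrier G. k \<otimes>\<^bsub>G\<^esub> h \<otimes>\<^bsub>G\<^esub> inv\<^bsub>G\<^esub> k) g"

text \<open>Conjugacy classes may be infinite, so "more than one element" is not phrased through
  \<^const>\<open>card\<close>.\<close>

definition UConj :: "('g, 'm) monoid_scheme \<Rightarrow> ('g \<times> 'g) set" where
  "UConj G = {(g, h) \<in> carrier G \<times> carrier G. g = h \<or>
     (\<exists>a \<in> conjugacy_class G g. \<exists>b \<in> conjugacy_class G g. a \<noteq> b) \<and>
     (\<exists>a \<in> conjugacy_class G h. \<exists>b \<in> conjugacy_class G h. a \<noteq> b)}"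

definition UConjGeo :: "('g, 'm) monoid_scheme \<Rightarrow> ('x \<Rightarrow> 'g) \<Rightarrow> 'x set \<Rightarrow> 'x word set" where
  "UConjGeo G \<iota> X = {w \<in> Geo G \<iota> X.
     \<forall>u \<in> Geo G \<iota> X. (word_eval G \<iota> w, word_eval G \<iota> u) \<in> UConj G \<longrightarrow> length w \<le> length u}"


section \<open>Piecewise testable languages\<close>

text \<open>\<open>piece_lang A [a\<^sub>1, \<dots>, a\<^sub>k]\<close> is \<open>A\<^sup>* a\<^sub>1 A\<^sup>* \<cdots> A\<^sup>* a\<^sub>k A\<^sup>*\<close>.\<close>

fun piece_lang :: "'c set \<Rightarrow> 'c list \<Rightarrow> 'c list set" where
  "piece_lang A [] = lists A"
| "piece_lang A (a # as) = {u @ a # v | u v. u \<in> lists A \<and> v \<in> piece_lang A as}"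

inductive piecewise_testable :: "'c set \<Rightarrow> 'c list set \<Rightarrow> bool" for A :: "'c set" where
  piece: "as \<in> lists A \<Longrightarrow> piecewise_testable A (piece_lang A as)"
| compl: "piecewise_testable A L \<Longrightarrow> piecewise_testable A (lists A - L)"
| union: "piecewise_testable A L \<Longrightarrow> piecewise_testable A K \<Longrightarrow> piecewise_testable A (L \<union> K)"
| inter: "piecewise_testable A L \<Longrightarrow> piecewise_testable A K \<Longrightarrow> piecewise_testable A (L \<inter> K)"


section \<open>Groups given by generators and relations\<close>

text \<open>\<open>(u, v) \<in> R\<close> encodes the defining relation \<open>u = v\<close>. The group presented by \<open>X\<close> and \<open>R\<close> is
  the quotient of the free monoid on \<open>letters X\<close> by the monoid congruence generated by \<open>R\<close> and
  the cancellation of mutually inverse letters. Its universal property is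
  \<open>presented_group_universal\<close> below.\<close>

inductive_set word_cong :: "'x set \<Rightarrow> ('x word \<times> 'x word) set \<Rightarrow> ('x word \<times> 'x word) set"
  for X :: "'x set" and R :: "('x word \<times> 'x word) set" where
  relation: "(u, v) \<in> R \<Longrightarrow> u \<in> lists (letters X) \<Longrightarrow> v \<in> lists (letters X) \<Longrightarrow> (u, v) \<in> word_cong X R"
| cancel: "x \<in> X \<Longrightarrow> ([(x, b), (x, \<not> b)], []) \<in> word_cong X R"
| refl: "u \<in> lists (letters X) \<Longrightarrow> (u, u) \<in> word_cong X R"
| sym: "(u, v) \<in> word_cong X R \<Longrightarrow> (v, u) \<in> word_cong X R"
| trans: "(u, v) \<in> word_cong X R \<Longrightarrow> (v, w) \<in> word_cong X R \<Longrightarrow> (u, w) \<in> word_cong X R"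
| append: "(u, u') \<in> word_cong X R \<Longrightarrow> (v, v') \<in> word_cong X R \<Longrightarrow> (u @ v, u' @ v') \<in> word_cong X R"

definition presented_group :: "'x set \<Rightarrow> ('x word \<times> 'x word) set \<Rightarrow> 'x word set monoid" where
  "presented_group X R =
     \<lparr>carrier = lists (letters X) // word_cong X R,
      monoid.mult = (\<lambda>P Q. \<Union>u \<in> P. \<Union>v \<in> Q. word_cong X R `` {u @ v}),
      one = word_cong X R `` {[]}\<rparr>"

definition presented_gen :: "'x set \<Rightarrow> ('x word \<times> 'x word) set \<Rightarrow> 'x \<Rightarrow> 'x word set" where
  "presented_gen X R x = word_cong X R `` {[(x, True)]}"

lemma word_cong_in_lists:
  "(u, v) \<in> word_cong X R \<Longrightarrow> u \<in> lists (letters X) \<and> v \<in> lists (letters X)"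
  by (induction rule: word_cong.induct) (auto simp: letters_def)

lemma equiv_word_cong: "equiv (lists (letters X)) (word_cong X R)"
proof (rule equivI)
  show "word_cong X R \<subseteq> lists (letters X) \<times> lists (letters X)"
    using word_cong_in_lists by fast
  show "refl_on (lists (letters X)) (word_cong X R)"
    by (rule refl_onI) (rule word_cong.refl)
  show "Relation.sym (word_cong X R)" by (rule symI) (rule word_cong.sym)
  show "Relation.trans (word_cong X R)" by (rule transI) (rule word_cong.trans)
qed

lemma presented_mult:
  assumes "u \<in> lists (letters X)" "v \<in> lists (letters X)"
  shows "(word_cong X R `` {u}) \<otimes>\<^bsub>presented_group X R\<^esub> (word_cong X R `` {v})
         = word_cong X R `` {u @ v}"
proof -
  let ?P = "word_cong X R `` {u}" and ?Q = "word_cong X R `` {v}"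
  have "word_cong X R `` {u' @ v'} = word_cong X R `` {u @ v}" if "u' \<in> ?P" "v' \<in> ?Q" for u' v'
    using equiv_class_eq[OF equiv_word_cong word_cong.append[of u u' X R v v']] that by blast
  moreover have "u \<in> ?P" "v \<in> ?Q"
    using word_cong.refl[OF assms(1), of R] word_cong.refl[OF assms(2), of R] by blast+
  ultimately have "(\<Union>u' \<in> ?P. \<Union>v' \<in> ?Q. word_cong X R `` {u' @ v'}) = word_cong X R `` {u @ v}"
    by blast
  then show ?thesis by (simp add: presented_group_def)
qed

lemma carrier_presentedE:
  assumes "P \<in> carrier (presented_group X R)"
  obtains u where "u \<in> lists (letters X)" "P = word_cong X R `` {u}"
  using assms unfolding presented_group_def by (simp del: in_lists_conv_set) (erule quotientE)

lemma carrier_presentedI: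
  "u \<in> lists (letters X) \<Longrightarrow> word_cong X R `` {u} \<in> carrier (presented_group X R)"
  unfolding presented_group_def by (auto intro: quotientI)

lemma word_cong_inverse:
  assumes "u \<in> lists (letters X)"
  shows "(rev (map (\<lambda>(x, b). (x, \<not> b)) u) @ u, []) \<in> word_cong X R"
  using assms
proof (induction u rule: list.induct)
  case Nil
  then show ?case by (simp add: word_cong.refl)
next
  case (Cons a u)
  obtain x b where a: "a = (x, b)" by force
  let ?v = "rev (map (\<lambda>(x, b). (x, \<not> b)) u)"
  have v: "?v \<in> lists (letters X)" and u: "u \<in> lists (letters X)" and x: "x \<in> X"
    using Cons.prems a by (auto simp: letters_def)
  have "([(x, \<not> b), (x, b)], []) \<in> word_cong X R"
    using word_cong.cancel[OF x, of "\<not> b"] by simp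
  from word_cong.append[OF word_cong.refl[OF v] word_cong.append[OF this word_cong.refl[OF u]]]
  have "(?v @ [(x, \<not> b), (x, b)] @ u, ?v @ u) \<in> word_cong X R" by simp
  from word_cong.trans[OF this Cons.IH[OF u]] show ?case using a by simp
qed

lemma group_presented_group: "group (presented_group X R)"
proof (rule groupI)
  have one: "\<one>\<^bsub>presented_group X R\<^esub> = word_cong X R `` {[]}"
    by (simp add: presented_group_def)
  show "\<one>\<^bsub>presented_group X R\<^esub> \<in> carrier (presented_group X R)"
    unfolding one by (rule carrier_presentedI) simp
  fix P assume "P \<in> carrier (presented_group X R)"
  then obtain u where u: "u \<in> lists (letters X)" "P = word_cong X R `` {u}"
    by (rule carrier_presentedE)
  show "\<one>\<^bsub>presented_group X R\<^esub> \<otimes>\<^bsub>presented_group X R\<^esub> P = P"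
    unfolding one u(2) using presented_mult[of "[]" X u R] u(1) by simp
  let ?v = "rev (map (\<lambda>(x, b). (x, \<not> b)) u)"
  have v: "?v \<in> lists (letters X)" using u(1) by (auto simp: letters_def)
  show "\<exists>Q \<in> carrier (presented_group X R).
      Q \<otimes>\<^bsub>presented_group X R\<^esub> P = \<one>\<^bsub>presented_group X R\<^esub>"
    unfolding one u(2)
    using presented_mult[OF v u(1), of R] carrier_presentedI[OF v, of R]
      equiv_class_eq[OF equiv_word_cong word_cong_inverse[OF u(1), of R]] by auto
  fix Q assume "Q \<in> carrier (presented_group X R)"
  then obtain v where v: "v \<in> lists (letters X)" "Q = word_cong X R `` {v}"
    by (rule carrier_presentedE)
  show "P \<otimes>\<^bsub>presented_group X R\<^esub> Q \<in> carrier (presented_group X R)"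
    unfolding u(2) v(2) presented_mult[OF u(1) v(1)]
    using u(1) v(1) by (intro carrier_presentedI) auto
  fix S assume "S \<in> carrier (presented_group X R)"
  then obtain w where w: "w \<in> lists (letters X)" "S = word_cong X R `` {w}"
    by (rule carrier_presentedE)
  show "P \<otimes>\<^bsub>presented_group X R\<^esub> Q \<otimes>\<^bsub>presented_group X R\<^esub> S
      = P \<otimes>\<^bsub>presented_group X R\<^esub> (Q \<otimes>\<^bsub>presented_group X R\<^esub> S)"
  proof -
    have uv: "u @ v \<in> lists (letters X)" and vw: "v @ w \<in> lists (letters X)"
      using u(1) v(1) w(1) by auto
    show ?thesis
      unfolding u(2) v(2) w(2) presented_mult[OF u(1) v(1)] presented_mult[OF v(1) w(1)]
        presented_mult[OF uv w(1)] presented_mult[OF u(1) vw] by simp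
  qed
qed

lemma word_eval_presented:
  assumes "u \<in> lists (letters X)"
  shows "word_eval (presented_group X R) (presented_gen X R) u = word_cong X R `` {u}"
  using assms
proof (induction u rule: list.induct)
  case Nil
  then show ?case by (simp add: presented_group_def)
next
  case (Cons a u)
  interpret group "presented_group X R" by (rule group_presented_group)
  obtain x b where a: "a = (x, b)" by force
  have x: "x \<in> X" and u: "u \<in> lists (letters X)"
    using Cons.prems a by (auto simp: letters_def)
  have l: "[(x, c)] \<in> lists (letters X)" for c using x by (simp add: letters_def)
  have "(word_cong X R `` {[(x, False)]}) \<otimes>\<^bsub>presented_group X R\<^esub> (word_cong X R `` {[(x, True)]})
      = \<one>\<^bsub>presented_group X R\<^esub>"
    unfolding presented_mult[OF l l]
    using equiv_class_eq[OF equiv_word_cong word_cong.cancel[OF x, of False R]]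
    by (simp add: presented_group_def)
  then have "inv\<^bsub>presented_group X R\<^esub> (presented_gen X R x) = word_cong X R `` {[(x, False)]}"
    unfolding presented_gen_def by (intro inv_equality carrier_presentedI l)
  then have "letter_eval (presented_group X R) (presented_gen X R) a = word_cong X R `` {[a]}"
    by (cases b) (simp_all add: letter_eval_def a presented_gen_def)
  then show ?case
    using Cons.IH[OF u] presented_mult[OF l[of b] u, of R] by (simp add: a)
qed

lemma word_eval_closed:
  assumes "group H" "\<And>x. x \<in> X \<Longrightarrow> f x \<in> carrier H" "w \<in> lists (letters X)"
  shows "word_eval H f w \<in> carrier H"
proof -
  interpret group H by fact
  show ?thesis using assms(3,2)
    by (induction w rule: list.induct) (auto simp: letter_eval_def letters_def)
qed

lemma word_eval_append:
  assumes "group H" "\<And>x. x \<in> X \<Longrightarrow> f x \<in> carrier H"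
    "u \<in> lists (letters X)" "v \<in> lists (letters X)"
  shows "word_eval H f (u @ v) = word_eval H f u \<otimes>\<^bsub>H\<^esub> word_eval H f v"
proof -
  interpret group H by fact
  have c: "word_eval H f w \<in> carrier H" if "w \<in> lists (letters X)" for w
    using word_eval_closed[of H X f w] assms(1,2) that by blast
  show ?thesis using assms(3)
  proof (induction u rule: list.induct)
    case Nil
    then show ?case using c[OF assms(4)] by simp
  next
    case (Cons a u)
    have "letter_eval H f a \<in> carrier H" "u \<in> lists (letters X)"
      using Cons.prems assms(2) by (auto simp: letter_eval_def letters_def)
    then show ?case using Cons.IH c[of u] c[OF assms(4)] by (simp add: m_assoc)
  qed
qed

lemma presented_group_universal:
  assumes H: "group H" and f: "\<And>x. x \<in> X \<Longrightarrow> f x \<in> carrier H"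
    and R: "\<And>u v. (u, v) \<in> R \<Longrightarrow> word_eval H f u = word_eval H f v"
  shows "\<exists>\<phi> \<in> hom (presented_group X R) H. \<forall>x \<in> X. \<phi> (presented_gen X R x) = f x"
proof -
  interpret group H by fact
  have resp: "word_eval H f u = word_eval H f v" if "(u, v) \<in> word_cong X R" for u v
    using that
  proof (induction rule: word_cong.induct)
    case (cancel x b)
    then show ?case using f by (cases b) (simp_all add: letter_eval_def)
  next
    case (append u u' v v')
    have "u \<in> lists (letters X)" "u' \<in> lists (letters X)"
      "v \<in> lists (letters X)" "v' \<in> lists (letters X)"
      using word_cong_in_lists[OF append.hyps(1)] word_cong_in_lists[OF append.hyps(2)] by blast+
    then show ?case
      using append.IH word_eval_append[of H X f u v] word_eval_append[of H X f u' v'] H f by simp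
  qed (auto intro: R)
  define \<phi> where "\<phi> P = word_eval H f (SOME u. u \<in> P)" for P
  have \<phi>: "\<phi> (word_cong X R `` {u}) = word_eval H f u" if u: "u \<in> lists (letters X)" for u
  proof -
    have "u \<in> word_cong X R `` {u}" using word_cong.refl[OF u, of R] by simp
    then have "(SOME v. v \<in> word_cong X R `` {u}) \<in> word_cong X R `` {u}" by (rule someI)
    then have "word_eval H f u = word_eval H f (SOME v. v \<in> word_cong X R `` {u})"
      by (intro resp) simp
    then show ?thesis unfolding \<phi>_def by simp
  qed
  have "\<phi> \<in> hom (presented_group X R) H"
  proof (rule homI)
    fix P assume "P \<in> carrier (presented_group X R)"
    then obtain u where u: "u \<in> lists (letters X)" "P = word_cong X R `` {u}"
      by (rule carrier_presentedE)
    show "\<phi> P \<in> carrier H" unfolding u(2) \<phi>[OF u(1)] by (rule word_eval_closed[OF H f u(1)])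
    fix Q assume "Q \<in> carrier (presented_group X R)"
    then obtain v where v: "v \<in> lists (letters X)" "Q = word_cong X R `` {v}"
      by (rule carrier_presentedE)
    have uv: "u @ v \<in> lists (letters X)" using u(1) v(1) by auto
    show "\<phi> (P \<otimes>\<^bsub>presented_group X R\<^esub> Q) = \<phi> P \<otimes>\<^bsub>H\<^esub> \<phi> Q"
      unfolding u(2) v(2) presented_mult[OF u(1) v(1)] \<phi>[OF u(1)] \<phi>[OF v(1)] \<phi>[OF uv]
      by (rule word_eval_append[OF H f u(1) v(1)])
  qed
  moreover have "\<phi> (presented_gen X R x) = f x" if "x \<in> X" for x
    using \<phi>[of "[(x, True)]"] that f[OF that]
    by (simp add: presented_gen_def letter_eval_def letters_def)
  ultimately show ?thesis by blast
qed


section \<open>Right-angled Artin groups\<close>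

definition raag_relations :: "'a pair_pre_digraph \<Rightarrow> ('a word \<times> 'a word) set" where
  "raag_relations \<Gamma> =
     {([(x, True), (y, True)], [(y, True), (x, True)]) | x y. (x, y) \<in> parcs \<Gamma>}"

definition raag :: "'a pair_pre_digraph \<Rightarrow> 'a word set monoid" where
  "raag \<Gamma> = presented_group (pverts \<Gamma>) (raag_relations \<Gamma>)"

definition raag_gen :: "'a pair_pre_digraph \<Rightarrow> 'a \<Rightarrow> 'a word set" where
  "raag_gen \<Gamma> = presented_gen (pverts \<Gamma>) (raag_relations \<Gamma>)"

end

theory Submission
  imports Defs "HOL-Library.Sublist" "HOL-Library.Multiset"
begin

text \<open>Call a vertex central if it is adjacent to all others. The UConj-geodesics are the geodesics of
  central elements together with the one-letter words on noncentral vertices, because every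
  noncentral element has length at least one. It remains to see that a geodesic represents a central
  element iff all its vertices are central: then these geodesics are the words that avoid
  the noncentral letters and the pairs of mutually inverse letters. A noncentral letter in a
  geodesic of a central element is excluded by the action of the group on pilings, an
  invariant of group elements that records the order of noncommuting letters in a geodesic.\<close>

section \<open>Piecewise testable languages\<close>

lemma subseq_Cons_iff: "subseq (a # as) w \<longleftrightarrow> (\<exists>u v. w = u @ a # v \<and> subseq as v)"
  using list_emb_ConsD[of "(=)" a as w] by auto

lemma subseq_pair:
  assumes "a \<in> set w" "b \<in> set w" "a \<noteq> b"
  shows "subseq [a, b] w \<or> subseq [b, a] w"
  using assms by (induction w) (auto simp: subseq_singleton_left)

text \<open>Translates the recursive languages of the definition into scattered subwords, so that
  forbidden patterns can be expressed by \<open>subseq\<close>.\<close>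

lemma piece_lang_eq_subseq:
  "as \<in> lists A \<Longrightarrow> piece_lang A as = {w \<in> lists A. subseq as w}"
proof (induction as)
  case (Cons a as)
  have "w \<in> piece_lang A (a # as) \<longleftrightarrow> w \<in> {w \<in> lists A. subseq (a # as) w}" for w
  proof -
    have "w \<in> piece_lang A (a # as)
        \<longleftrightarrow> (\<exists>u v. w = u @ a # v \<and> u \<in> lists A \<and> v \<in> lists A \<and> subseq as v)"
      using Cons by auto
    also have "\<dots> \<longleftrightarrow> w \<in> lists A \<and> (\<exists>u v. w = u @ a # v \<and> subseq as v)"
      using Cons.prems by fastforce
    finally show ?thesis by (simp only: subseq_Cons_iff mem_Collect_eq)
  qed
  then show ?case by blast
qed simp

lemma piecewise_testable_lists: "piecewise_testable A (lists A)"
  using piecewise_testable.piece[of "[]" A] by simp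

lemma piecewise_testable_empty: "piecewise_testable A {}"
  using piecewise_testable.compl[OF piecewise_testable_lists[of A]] by simp

lemma piecewise_testable_Union:
  assumes "finite I" "\<And>i. i \<in> I \<Longrightarrow> piecewise_testable A (L i)"
  shows "piecewise_testable A (\<Union>i \<in> I. L i)"
  using assms
  by (induction I) (simp_all add: piecewise_testable_empty piecewise_testable.union)

text \<open>The complement of a finite union of piece languages.\<close>

lemma piecewise_testable_avoiding:
  assumes "finite F" "F \<subseteq> lists A"
  shows "piecewise_testable A {w \<in> lists A. \<forall>as \<in> F. \<not> subseq as w}"
proof -
  have "piecewise_testable A (lists A - (\<Union>as \<in> F. piece_lang A as))"
    using assms by (intro piecewise_testable.compl piecewise_testable_Union piecewise_testable.piece) auto
  also have "lists A - (\<Union>as \<in> F. piece_lang A as) = {w \<in> lists A. \<forall>as \<in> F. \<not> subseq as w}"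
    using assms(2) by (auto simp: piece_lang_eq_subseq subset_iff simp del: in_lists_conv_set)
  finally show ?thesis .
qed

text \<open>A one-letter word on \<open>B\<close> is characterized by containing a letter of
  \<open>B\<close> and no scattered subword of length two.\<close>

lemma piecewise_testable_singletons:
  assumes "finite A" "B \<subseteq> A"
  shows "piecewise_testable A {[a] | a. a \<in> B}"
proof -
  let ?F = "(\<lambda>(b, c). [b, c]) ` (A \<times> A)"
  have "piecewise_testable A ((\<Union>a \<in> B. piece_lang A [a])
      \<inter> {w \<in> lists A. \<forall>as \<in> ?F. \<not> subseq as w})"
    using assms finite_subset[OF assms(2,1)]
    by (intro piecewise_testable.inter piecewise_testable_Union piecewise_testable.piece
        piecewise_testable_avoiding) auto
  also have "(\<Union>a \<in> B. piece_lang A [a]) \<inter> {w \<in> lists A. \<forall>as \<in> ?F. \<not> subseq as w}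
      = {[a] | a. a \<in> B}"
    (is "?L = ?R")
  proof (intro equalityI subsetI)
    fix w assume w: "w \<in> ?L"
    then obtain a where a: "a \<in> B" "subseq [a] w" "w \<in> lists A"
      using assms(2) piece_lang_eq_subseq[of "[_]" A] by auto
    show "w \<in> ?R"
    \<comment> \<open>The rule only serves to split into the empty word, one letter, and at least
      two letters.\<close>
    proof (cases w rule: remdups_adj.cases)
      case (3 b c v)
      then have "[b, c] \<in> ?F" "subseq [b, c] w" using a(3) by auto
      then show ?thesis using w by blast
    qed (use a in \<open>auto split: if_splits\<close>)
  next
    fix w assume "w \<in> ?R"
    then obtain a where a: "w = [a]" "a \<in> B" by blast
    then have "w \<in> piece_lang A [a]" using a assms(2) by (subst piece_lang_eq_subseq) auto
    then show "w \<in> ?L" using a assms(2) by (auto split: if_splits simp del: piece_lang.simps)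
  qed
  finally show ?thesis .
qed

section \<open>Words in a right-angled Artin group\<close>

definition flip :: "'x letter \<Rightarrow> 'x letter" where
  "flip a = (fst a, \<not> snd a)"

lemma flip_simps [simp]: "fst (flip a) = fst a" "snd (flip a) = (\<not> snd a)" "flip (flip a) = a"
  by (simp_all add: flip_def)

lemma flip_neq [simp]: "flip a \<noteq> a" "a \<noteq> flip a"
  by (simp_all add: flip_def prod_eq_iff)

lemma letters_iff: "a \<in> letters X \<longleftrightarrow> fst a \<in> X"
  by (cases a) (simp add: letters_def)

lemma flip_letters [simp]: "flip a \<in> letters X \<longleftrightarrow> a \<in> letters X"
  by (simp add: letters_iff)

context pair_graph
begin

abbreviation words :: "'a word set" where
  "words \<equiv> lists (letters (pverts G))"

abbreviation weq :: "'a word \<Rightarrow> 'a word \<Rightarrow> bool" (infix \<open>\<approx>\<close> 50) where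
  "u \<approx> v \<equiv> (u, v) \<in> word_cong (pverts G) (raag_relations G)"

text \<open>Centrality of the represented element, kept at the level of words;
  \<open>noncentral_iff\<close> links it to conjugacy classes.\<close>

definition commuting :: "'a word \<Rightarrow> bool" where
  "commuting w \<longleftrightarrow> (\<forall>u \<in> words. u @ w \<approx> w @ u)"

definition geodesic :: "'a word \<Rightarrow> bool" where
  "geodesic w \<longleftrightarrow> w \<in> words \<and> (\<forall>u. u \<approx> w \<longrightarrow> length w \<le> length u)"

definition central_verts :: "'a set" where
  "central_verts = {x \<in> pverts G. \<forall>y \<in> pverts G. y = x \<or> (x, y) \<in> parcs G}"

lemma central_letters_subset: "letters central_verts \<subseteq> letters (pverts G)"
  by (auto simp: letters_iff central_verts_def)

lemma central_verts_adj:
  "x \<in> central_verts \<Longrightarrow> y \<in> pverts G \<Longrightarrow> y \<noteq> x \<Longrightarrow> (x, y) \<in> parcs G"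
  unfolding central_verts_def by blast

section \<open>Commutation and cancellation of letters\<close>

lemma weq_words: "u \<approx> v \<Longrightarrow> u \<in> words" "u \<approx> v \<Longrightarrow> v \<in> words"
  using word_cong_in_lists by blast+

lemma weq_context:
  assumes "u \<approx> v" "s \<in> words" "t \<in> words"
  shows "s @ u @ t \<approx> s @ v @ t"
  using assms by (intro word_cong.append word_cong.refl)

lemma weq_cancel: "a \<in> letters (pverts G) \<Longrightarrow> [a, flip a] \<approx> []"
  using word_cong.cancel[of "fst a" "pverts G" "snd a"] by (cases a) (auto simp: flip_def letters_def)

text \<open>The given relation is multiplied by the inverse of \<open>a\<close> on both
  sides.\<close>

lemma weq_flip_commute:
  assumes a: "a \<in> letters (pverts G)" and u: "u \<in> words" and "a # u \<approx> u @ [a]"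
  shows "flip a # u \<approx> u @ [flip a]"
proof -
  have "flip a # u \<approx> flip a # u @ [a, flip a]"
    using weq_context[OF word_cong.sym[OF weq_cancel[OF a]], of "flip a # u" "[]"] a u by simp
  also have "flip a # u @ [a, flip a] \<approx> flip a # a # u @ [flip a]"
    using weq_context[OF word_cong.sym[OF assms(3)], of "[flip a]" "[flip a]"] a by simp
  also (word_cong.trans) have "flip a # a # u @ [flip a] \<approx> u @ [flip a]"
    using weq_context[OF weq_cancel[of "flip a"], of "[]" "u @ [flip a]"] a u by simp
  finally (word_cong.trans) show ?thesis .
qed

text \<open>The defining relations contain positive letters only; the signs of the two letters are
  adjusted one after the other by \<open>weq_flip_commute\<close>.\<close>

lemma weq_letters_commute:
  assumes "(fst a, fst c) \<in> parcs G"
  shows "[a, c] \<approx> [c, a]"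
proof -
  obtain x b y d where ac: "a = (x, b)" "c = (y, d)" by force
  have xy: "x \<in> pverts G" "y \<in> pverts G" "(x, y) \<in> parcs G"
    using assms ac in_arcsD1 in_arcsD2 by auto
  have l: "(x, e) \<in> letters (pverts G)" "(y, e) \<in> letters (pverts G)" for e
    using xy by (auto simp: letters_def)
  have "[(x, True), (y, True)] \<approx> [(y, True), (x, True)]"
    using xy l by (intro word_cong.relation) (auto simp: raag_relations_def)
  then have 1: "[(x, b), (y, True)] \<approx> [(y, True), (x, b)]"
    using weq_flip_commute[of "(x, True)" "[(y, True)]"] l by (cases b) (simp_all add: flip_def)
  then show ?thesis
    using weq_flip_commute[of "(y, True)" "[(x, b)]"] l word_cong.sym[OF 1] ac 1
      word_cong.sym[of "[(y, False), (x, b)]"]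
    by (cases d) (simp_all add: flip_def)
qed

lemma letter_central_commute:
  assumes "a \<in> letters central_verts" "u \<in> words"
  shows "u @ [a] \<approx> [a] @ u"
  using assms(2)
proof (induction u rule: list.induct)
  case Nil
  have "[a] \<in> words" using assms(1) central_letters_subset by auto
  then show ?case by (simp add: word_cong.refl del: in_lists_conv_set)
next
  case (Cons c u)
  have a: "a \<in> letters (pverts G)" using assms(1) central_letters_subset by blast
  have c: "c \<in> letters (pverts G)" using Cons by simp
  have 1: "[c, a] \<approx> [a, c]"
  proof (cases "fst c = fst a")
    case True
    consider "c = a" | "c = flip a" using True by (cases a; cases c) (auto simp: flip_def)
    then show ?thesis
    proof cases
      case 1
      then show ?thesis using a by (simp add: word_cong.refl)
    next
      case 2
      then show ?thesis
        \<comment> \<open>Both products of \<open>a\<close> and its inverse cancel to the empty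
          word.\<close>
        using word_cong.trans[OF weq_cancel[of "flip a"] word_cong.sym[OF weq_cancel[OF a]]] a by simp
    qed
  next
    case False
    then have "(fst a, fst c) \<in> parcs G"
      using assms(1) c by (intro central_verts_adj) (simp_all add: letters_iff)
    then show ?thesis by (rule weq_letters_commute[OF arcs_symmetric])
  qed
  have "c # u @ [a] \<approx> c # a # u"
    using weq_context[of "u @ [a]" "[a] @ u" "[c]" "[]"] Cons by simp
  also have "c # a # u \<approx> a # c # u"
    using weq_context[OF 1, of "[]" u] Cons by simp
  finally (word_cong.trans) show ?case by simp
qed

lemma commuting_if_central_letters:
  assumes "w \<in> lists (letters central_verts)"
  shows "commuting w"
  unfolding commuting_def
proof
  fix u assume u: "u \<in> words"
  from assms show "u @ w \<approx> w @ u"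
  proof (induction w rule: list.induct)
    case Nil
    then show ?case using word_cong.refl[OF u] by simp
  next
    case (Cons a w)
    have W: "a \<in> letters (pverts G)" "w \<in> words"
      using Cons central_letters_subset by auto
    have "u @ a # w \<approx> a # u @ w"
      using weq_context[OF letter_central_commute[of a u], of "[]" w] Cons u W by simp
    also have "a # u @ w \<approx> a # w @ u"
      using weq_context[of "u @ w" "w @ u" "[a]" "[]"] Cons W by simp
    finally (word_cong.trans) show ?case by simp
  qed
qed

section \<open>Geodesics recognized by exponent sums\<close>

definition exponent :: "'a \<Rightarrow> 'a word \<Rightarrow> int" where
  "exponent x w = int (count_list w (x, True)) - int (count_list w (x, False))"

text \<open>Exponent sums are the coordinates of the abelianization: the relations permute letters,
  and cancelled letters contribute opposite signs.\<close>

lemma exponent_weq: "u \<approx> v \<Longrightarrow> exponent x u = exponent x v"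
  by (induction rule: word_cong.induct) (auto simp: exponent_def raag_relations_def)

text \<open>Without inverse pairs, the multiplicity of each letter of \<open>w\<close> is the
  absolute value of the exponent sum of its vertex, so every word for the same element has at least
  as many copies of it.\<close>

lemma geodesic_if_no_inverse_letters:
  assumes "w \<in> words" "\<And>a. a \<in> set w \<Longrightarrow> flip a \<notin> set w"
  shows "geodesic w"
  unfolding geodesic_def
proof (intro conjI allI impI)
  fix u assume u: "u \<approx> w"
  have "mset w \<subseteq># mset u"
  proof (rule mset_subset_eqI)
    fix a :: "'a letter"
    obtain x b where a: "a = (x, b)" by force
    show "count (mset w) a \<le> count (mset u) a"
    proof (cases "a \<in> set w")
      case True
      then have "count_list w (x, \<not> b) = 0" using assms(2)[of a] a by (simp add: flip_def count_list_0_iff)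
      then show ?thesis
        using exponent_weq[OF u, of x] a by (cases b) (simp_all add: exponent_def count_mset)
    next
      case False
      then have "count (mset w) a = 0" by (simp add: count_eq_zero_iff)
      then show ?thesis by (rule ord_eq_le_trans) simp
    qed
  qed
  then show "length w \<le> length u" using size_mset_mono by fastforce
qed (use assms in simp)

lemma geodesic_letter: "a \<in> letters (pverts G) \<Longrightarrow> geodesic [a]"
  by (rule geodesic_if_no_inverse_letters) simp_all

text \<open>A central letter could be moved next to its inverse and cancelled, which would shorten
  the word by two.\<close>

lemma geodesic_central_no_inverse_letters:
  assumes "geodesic w" "a \<in> letters central_verts" "a \<in> set w"
  shows "\<not> subseq [a, flip a] w"
proof
  assume "subseq [a, flip a] w"
  then obtain u v t where w: "w = u @ a # v @ flip a # t"
    by (auto simp: subseq_Cons_iff)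
  have W: "u \<in> words" "v \<in> words" "t \<in> words" "a \<in> letters (pverts G)"
    using assms(1) w by (auto simp: geodesic_def)
  have "u @ v @ [a, flip a] @ t \<approx> w"
    using weq_context[OF letter_central_commute[OF assms(2), of v], of u "flip a # t"] W w by simp
  moreover have "u @ v @ [a, flip a] @ t \<approx> u @ v @ t"
    using weq_context[OF weq_cancel, of a "u @ v" t] W by simp
  ultimately have "u @ v @ t \<approx> w" using word_cong.trans word_cong.sym by metis
  then show False using assms(1) w by (auto simp: geodesic_def)
qed

section \<open>The action on pilings\<close>

text \<open>Following Crisp, Godelle and Wiest, a piling consists of one stack (with its top at the head
  of the list) for every vertex. Writing a letter puts its sign on the stack of its vertex and a
  bead \<open>None\<close> on the stacks of all vertices that do not commute with it.\<close>

type_synonym 'x piling = "'x \<Rightarrow> bool option list"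

definition beads :: "'a letter \<Rightarrow> 'a piling" where
  "beads a v = (if v = fst a then [Some (snd a)] else if (v, fst a) \<in> parcs G then [] else [None])"

definition push :: "'a piling \<Rightarrow> 'a letter \<Rightarrow> 'a piling" where
  "push p a v = beads a v @ p v"

text \<open>Removes as many beads as the letter or its inverse would add, without looking at them.
  On pilings of reduced words with the inverse letter on top, these are exactly the beads of that
  inverse.\<close>

definition pop :: "'a piling \<Rightarrow> 'a letter \<Rightarrow> 'a piling" where
  "pop p a v = drop (length (beads a v)) (p v)"

definition tops :: "'a piling \<Rightarrow> 'a letter \<Rightarrow> bool" where
  "tops p a \<longleftrightarrow> p (fst a) \<noteq> [] \<and> hd (p (fst a)) = Some (snd a)"

text \<open>A right action that cancels when possible. In general it respects cancellation of
  inverse letters only on pilings of reduced words, because a sign on top of one stack says nothing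
  about the other stacks of an arbitrary function.\<close>

definition act :: "'a piling \<Rightarrow> 'a letter \<Rightarrow> 'a piling" where
  "act p a = (if tops p (flip a) then pop p a else push p a)"

text \<open>The stacks after writing \<open>w\<close> from left to right without any cancellation;
  \<open>rev\<close> puts the last letter on top.\<close>

definition piling :: "'a word \<Rightarrow> 'a piling" where
  "piling w v = concat (map (\<lambda>a. beads a v) (rev w))"

text \<open>Running \<open>act\<close> along \<open>w\<close> from the empty piling never pops, so
  the run ends in \<open>piling w\<close>.\<close>

definition reduced :: "'a word \<Rightarrow> bool" where
  "reduced w \<longleftrightarrow> w \<in> words \<and> (\<forall>u a v. w = u @ a # v \<longrightarrow> \<not> tops (piling u) (flip a))"

lemma piling_Nil [simp]: "piling [] = (\<lambda>v. [])"
  by (simp add: piling_def fun_eq_iff)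

lemma piling_append: "piling (u @ w) v = piling w v @ piling u v"
  by (simp add: piling_def)

lemma piling_Cons: "piling (a # w) v = piling w v @ beads a v"
  by (simp add: piling_def)

lemma piling_snoc: "piling (w @ [a]) = push (piling w) a"
  by (simp add: piling_def push_def fun_eq_iff)

lemma reduced_Nil [simp]: "reduced []"
  by (simp add: reduced_def)

lemma reduced_snoc:
  "reduced (w @ [a]) \<longleftrightarrow> reduced w \<and> a \<in> letters (pverts G) \<and> \<not> tops (piling w) (flip a)"
  (is "?L \<longleftrightarrow> ?R")
proof
  assume L: ?L
  have "\<not> tops (piling u) (flip c)" if "w = u @ c # v" for u c v
  proof -
    have "w @ [a] = u @ c # (v @ [a])" using that by simp
    then show ?thesis using L unfolding reduced_def by blast
  qed
  moreover have "\<not> tops (piling w) (flip a)" using L unfolding reduced_def by blast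
  moreover have "w \<in> words" "a \<in> letters (pverts G)" using L unfolding reduced_def by auto
  ultimately show ?R unfolding reduced_def by blast
next
  assume R: ?R
  have "\<not> tops (piling u) (flip c)" if "w @ [a] = u @ c # v" for u c v
  proof (cases v rule: rev_cases)
    case Nil
    then show ?thesis using R that by simp
  next
    case (snoc v' b)
    then have "w = u @ c # v'" using that by simp
    then show ?thesis using R unfolding reduced_def by blast
  qed
  then show ?L using R unfolding reduced_def by auto
qed

section \<open>Pushing, popping and the tops of stacks\<close>

lemma pop_push_flip: "pop (push p a) (flip a) = p"
  by (auto simp: pop_def push_def beads_def fun_eq_iff)

lemma tops_push_same: "tops (push p a) c \<longleftrightarrow> c = a" if "fst c = fst a"
  using that by (cases a; cases c) (auto simp: tops_def push_def beads_def)

lemma tops_push_adj: "tops (push p a) c = tops p c" if "(fst a, fst c) \<in> parcs G"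
  using arcs_symmetric[OF that] no_loops'[OF that] by (auto simp: tops_def push_def beads_def)

lemma push_commute:
  assumes "(fst a, fst c) \<in> parcs G"
  shows "push (push p a) c = push (push p c) a"
  using assms arcs_symmetric[OF assms] no_loops'[OF assms] by (auto simp: push_def beads_def fun_eq_iff)

text \<open>A letter visible on top of its stack can be moved to the end of the word: every later
  letter left no bead on that stack and hence commutes with it.\<close>

lemma reduced_tops_split:
  assumes "reduced w" "tops (piling w) a"
  shows "\<exists>u. reduced (u @ [a]) \<and> piling w = piling (u @ [a]) \<and> w \<approx> u @ [a] \<and> length w = Suc (length u)"
  using assms
proof (induction w rule: rev_induct)
  case Nil
  then show ?case by (simp add: tops_def)
next
  case (snoc c w)
  have red: "reduced w" "c \<in> letters (pverts G)" "\<not> tops (piling w) (flip c)"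
    using snoc.prems(1) by (auto simp: reduced_snoc)
  show ?case
  proof (cases "fst c = fst a")
    case True
    then have "c = a" using snoc.prems(2) tops_push_same[OF True[symmetric]] by (simp add: piling_snoc)
    moreover have "w @ [c] \<in> words"
      using snoc.prems(1) unfolding reduced_def by (rule conjunct1)
    then have "w @ [c] \<approx> w @ [c]" by (rule word_cong.refl)
    ultimately show ?thesis using snoc.prems(1) by (intro exI[of _ w]) simp
  next
    case False
    \<comment> \<open>Otherwise \<open>c\<close> would have covered the stack of \<open>a\<close>
      with a bead \<open>None\<close>.\<close>
    then have adj: "(fst c, fst a) \<in> parcs G"
      using snoc.prems(2) arcs_symmetric[of "fst a" "fst c"]
      by (auto simp: piling_snoc tops_def push_def beads_def split: if_splits)
    have "tops (piling w) a" using snoc.prems(2) tops_push_adj[OF adj] by (simp add: piling_snoc)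
    then obtain u where u: "reduced (u @ [a])" "piling w = piling (u @ [a])" "w \<approx> u @ [a]"
        "length w = Suc (length u)"
      using snoc.IH[OF red(1)] by blast
    have adj': "(fst a, fst c) \<in> parcs G" using adj by (rule arcs_symmetric)
    have W: "u \<in> words" "a \<in> letters (pverts G)" using u(1) by (auto simp: reduced_def)
    \<comment> \<open>Adjacent letters do not touch each other's stacks, so exchanging them keeps
      the word reduced.\<close>
    have "tops (push p c) (flip a) = tops p (flip a)" "tops (push p a) (flip c) = tops p (flip c)" for p
      using adj adj' by (simp_all add: tops_push_adj)
    then have "reduced ((u @ [c]) @ [a])"
      using u(1,2) red(2,3) unfolding reduced_snoc piling_snoc by simp
    moreover have "piling (w @ [c]) = piling ((u @ [c]) @ [a])"
      using u(2) push_commute[OF adj'] unfolding piling_snoc by simp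
    moreover have "w @ [c] \<approx> u @ [c] @ [a]"
    proof -
      have "w @ [c] \<approx> u @ [a, c]" using weq_context[OF u(3), of "[]" "[c]"] red(2) by simp
      also have "u @ [a, c] \<approx> u @ [c, a]"
        using weq_context[OF weq_letters_commute[OF adj'], of u "[]"] W by simp
      finally (word_cong.trans) show ?thesis by simp
    qed
    ultimately show ?thesis using u(4) by (intro exI[of _ "u @ [c]"]) simp
  qed
qed

text \<open>Pilings of reduced words are closed under the action, and \<open>flip a\<close> undoes
  \<open>a\<close>. If \<open>a\<close> pops, its inverse may be taken as the last letter of the
  word, by \<open>reduced_tops_split\<close>.\<close>

lemma act_reduced:
  assumes "reduced w" "a \<in> letters (pverts G)"
  obtains u where "reduced u" "act (piling w) a = piling u" "act (piling u) (flip a) = piling w"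
proof (cases "tops (piling w) (flip a)")
  case True
  then obtain u where u: "reduced (u @ [flip a])" "piling w = piling (u @ [flip a])"
    using reduced_tops_split[OF assms(1)] by blast
  have "act (piling w) a = piling u"
    using True u(2) pop_push_flip[of _ "flip a"] by (simp add: act_def piling_snoc)
  moreover have "act (piling u) (flip a) = piling w"
    using u by (simp add: act_def reduced_snoc piling_snoc)
  moreover have "reduced u" using u(1) by (simp add: reduced_snoc)
  ultimately show ?thesis using that by blast
next
  case False
  then have "reduced (w @ [a])" "act (piling w) a = piling (w @ [a])"
    using assms by (auto simp: reduced_snoc act_def piling_snoc)
  moreover have "act (piling (w @ [a])) (flip a) = piling w"
    using tops_push_same[of a a] pop_push_flip by (simp add: act_def piling_snoc)
  ultimately show ?thesis using that by blast
qed

text \<open>Each of the two letters pushes or pops. As they do not change each other's tops, it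
  suffices that the corresponding operations commute.\<close>

lemma act_commute:
  assumes "reduced w" "(fst a, fst c) \<in> parcs G"
  shows "act (act (piling w) a) c = act (act (piling w) c) a"
proof -
  \<comment> \<open>The beads removed are those of \<open>flip b\<close>, since
    \<open>reduced_tops_split\<close> lets it be the last letter written.\<close>
  have pushes: "p = push (pop p b) (flip b)" if "p = piling w" "tops p (flip b)" for p b
  proof -
    obtain u where "piling w = piling (u @ [flip b])"
      using reduced_tops_split[OF assms(1)] \<open>p = piling w\<close> \<open>tops p (flip b)\<close> by blast
    then show ?thesis using that(1) pop_push_flip[of _ "flip b"] by (simp add: piling_snoc)
  qed
  have adj: "(fst c, fst a) \<in> parcs G" using assms(2) by (rule arcs_symmetric)
  have top_pop: "tops (pop p a') c' = tops p c'" if "(fst a', fst c') \<in> parcs G" for p a' c'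
    using that arcs_symmetric[OF that] no_loops'[OF that] by (auto simp: tops_def pop_def beads_def)
  have pop_pop: "pop (pop p a) c = pop (pop p c) a" for p
    by (simp add: pop_def fun_eq_iff add.commute)
  \<comment> \<open>In the mixed case the piling is rewritten as a push onto the popped piling,
    which reduces the claim to \<open>push_commute\<close>.\<close>
  have pop_push: "push (pop (piling w) a') c' = pop (push (piling w) c') a'"
    if "tops (piling w) (flip a')" "(fst a', fst c') \<in> parcs G" for a' c'
  proof -
    have "pop (push (piling w) c') a' = pop (push (push (pop (piling w) a') (flip a')) c') a'"
      using pushes[OF _ that(1)] by simp
    also have "\<dots> = pop (push (push (pop (piling w) a') c') (flip a')) a'"
      using push_commute[of "flip a'" c'] that(2) by simp
    also have "\<dots> = push (pop (piling w) a') c'"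
      using pop_push_flip[of _ "flip a'"] by simp
    finally show ?thesis by simp
  qed
  have tp: "tops (push p a) (flip c) = tops p (flip c)" "tops (push p c) (flip a) = tops p (flip a)"
    "tops (pop p a) (flip c) = tops p (flip c)" "tops (pop p c) (flip a) = tops p (flip a)" for p
    using assms(2) adj by (simp_all add: tops_push_adj top_pop)
  show ?thesis
    using pop_push[of a c] pop_push[of c a] assms(2) adj pop_pop push_commute[OF assms(2)]
    by (auto simp: act_def tp)
qed

section \<open>Invariance under the word congruence\<close>

lemma run_reduced:
  "reduced w \<Longrightarrow> u \<in> words \<Longrightarrow> \<exists>w'. reduced w' \<and> foldl act (piling w) u = piling w'"
proof (induction u arbitrary: w)
  case (Cons a u)
  have a: "a \<in> letters (pverts G)" and u: "u \<in> words" using Cons.prems(2) by auto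
  obtain w' where w': "reduced w'" "act (piling w) a = piling w'"
    using Cons.prems(1) a by (rule act_reduced)
  from Cons.IH[OF w'(1) u] show ?case by (simp add: w'(2))
qed auto

text \<open>Each rule generating the congruence is respected by the action, so the piling reached
  from the empty one is an invariant of the group element. For concatenation,
  \<open>run_reduced\<close> ensures that the second factor again starts at the piling of a reduced
  word.\<close>

lemma run_weq:
  "u \<approx> v \<Longrightarrow> reduced w \<Longrightarrow> foldl act (piling w) u = foldl act (piling w) v"
proof (induction arbitrary: w rule: word_cong.induct)
  case (relation u v)
  then obtain x y where "u = [(x, True), (y, True)]" "v = [(y, True), (x, True)]" "(x, y) \<in> parcs G"
    by (auto simp: raag_relations_def)
  then show ?case using act_commute[OF relation.prems, of "(x, True)" "(y, True)"] by simp
next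
  case (cancel x b)
  then have "(x, b) \<in> letters (pverts G)" by (simp add: letters_iff)
  with cancel.prems obtain u where "act (piling w) (x, b) = piling u"
    "act (piling u) (flip (x, b)) = piling w"
    by (rule act_reduced)
  then show ?case by (simp add: flip_def)
next
  case (append u u' v v')
  obtain w' where "reduced w'" "foldl act (piling w) u = piling w'"
    using run_reduced[OF append.prems] weq_words[OF append.hyps(1)] by blast
  then show ?case using append.IH(1)[OF append.prems] append.IH(2)[of w'] by simp
qed auto

text \<open>The start \<open>p\<close> is arbitrary, so that a word can be run on top of the beads
  of a letter written before it.\<close>

lemma run_without_pop:
  assumes "\<And>u a v. w = u @ a # v \<Longrightarrow> \<not> tops (\<lambda>x. piling u x @ p x) (flip a)"
  shows "foldl act p w = (\<lambda>x. piling w x @ p x)"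
  using assms
proof (induction w rule: rev_induct)
  case (snoc a w)
  have "foldl act p w = (\<lambda>x. piling w x @ p x)"
  proof (rule snoc.IH)
    fix u b v assume "w = u @ b # v"
    then have "w @ [a] = u @ b # (v @ [a])" by simp
    then show "\<not> tops (\<lambda>x. piling u x @ p x) (flip b)" by (rule snoc.prems)
  qed
  moreover have "\<not> tops (\<lambda>x. piling w x @ p x) (flip a)" by (rule snoc.prems) simp
  then have "act (\<lambda>x. piling w x @ p x) a = push (\<lambda>x. piling w x @ p x) a"
    by (simp add: act_def)
  ultimately show ?case by (simp add: push_def piling_append piling_Cons)
qed simp

section \<open>Geodesics and the action\<close>

lemma geodesic_butlast:
  assumes "geodesic (w @ [a])"
  shows "geodesic w"
proof -
  have W: "w \<in> words" "[a] \<in> words" using assms by (auto simp: geodesic_def)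
  have "length w \<le> length u" if "u \<approx> w" for u
    using assms weq_context[OF that, of "[]" "[a]"] W by (auto simp: geodesic_def)
  then show ?thesis using W by (simp add: geodesic_def)
qed

text \<open>If the last letter popped, its inverse could be moved to the end of the preceding word
  and cancelled against it.\<close>

lemma reduced_if_geodesic: "geodesic w \<Longrightarrow> reduced w"
proof (induction w rule: rev_induct)
  case (snoc a w)
  have red: "reduced w" using snoc geodesic_butlast by blast
  have a: "a \<in> letters (pverts G)" using snoc.prems by (auto simp: geodesic_def)
  have "\<not> tops (piling w) (flip a)"
  proof
    assume "tops (piling w) (flip a)"
    then obtain u where u: "w \<approx> u @ [flip a]" "length w = Suc (length u)"
      using reduced_tops_split[OF red] by blast
    have uW: "u \<in> words" using weq_words(2)[OF u(1)] by simp
    have "w @ [a] \<approx> u @ [flip a, a]" using weq_context[OF u(1), of "[]" "[a]"] a by simp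
    also have "u @ [flip a, a] \<approx> u"
      using weq_context[OF weq_cancel[of "flip a"], of u "[]"] a uW by simp
    finally (word_cong.trans) have "u \<approx> w @ [a]" by (rule word_cong.sym)
    then show False using snoc.prems u(2) by (auto simp: geodesic_def)
  qed
  then show ?case using red a by (simp add: reduced_snoc)
qed simp

text \<open>Let \<open>(x, e)\<close> be the first noncentral letter of a geodesic \<open>w\<close>, and let \<open>y\<close> not commute with
  \<open>x\<close>. With a suitable sign \<open>f\<close>, neither \<open>w (y, f)\<close> nor \<open>(y, f) w\<close> pops a bead, so the bottom of
  the stack of \<open>x\<close> is the sign \<open>e\<close> for the former word and a bead \<open>None\<close> for the latter.\<close>

lemma geodesic_commuting_central_letters:
  assumes geo: "geodesic w" and comm: "commuting w"
  shows "w \<in> lists (letters central_verts)"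
proof (rule ccontr)
  assume "\<not> ?thesis"
  then have "\<exists>a \<in> set w. a \<notin> letters central_verts" by auto
  then obtain c a t where w: "w = c @ a # t" and a: "a \<notin> letters central_verts"
    and c: "\<forall>d \<in> set c. d \<in> letters central_verts"
    using split_list_first_prop[of w "\<lambda>a. a \<notin> letters central_verts"] by blast
  obtain x e where xe: "a = (x, e)" by force
  have "a \<in> letters (pverts G)" using geo w by (auto simp: geodesic_def)
  then have x: "x \<in> pverts G" "x \<notin> central_verts" using a xe by (auto simp: letters_def)
  then obtain y where y: "y \<in> pverts G" "y \<noteq> x" "(x, y) \<notin> parcs G"
    by (auto simp: central_verts_def)
  have yx: "(y, x) \<notin> parcs G" using y arcs_symmetric by blast
  have yc: "y \<notin> central_verts" using yx x(1) y(2) by (auto simp: central_verts_def)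
  have red: "\<not> tops (piling u) (flip b)" if "w = u @ b # v" for u b v
    using reduced_if_geodesic[OF geo] that unfolding reduced_def by blast
  have run_w: "foldl act (piling []) w = piling w"
    using run_without_pop[of w "\<lambda>x. []"] red by simp
  \<comment> \<open>At most one sign of \<open>y\<close> is on top of its stack; \<open>f\<close> is
    chosen so that the opposite sign is not.\<close>
  define f where "f = (\<not> tops (piling w) (y, False))"
  have f: "\<not> tops (piling w) (flip (y, f))"
    by (cases "tops (piling w) (y, False)") (auto simp: f_def flip_def tops_def)
  have "foldl act (piling []) (w @ [(y, f)]) x = None # piling w x"
    using f run_w y by (simp add: act_def push_def beads_def)
  moreover have "foldl act (piling []) ((y, f) # w) x = piling w x @ [None]"
  proof -
    \<comment> \<open>The beads of \<open>(y, f)\<close> lie at the bottom. Where \<open>u\<close>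
      has left beads, the top is the same as for \<open>w\<close> alone; elsewhere only the stack of
      \<open>y\<close> could show a sign.\<close>
    have "\<not> tops (\<lambda>v. piling u v @ beads (y, f) v) (flip b)" if split: "w = u @ b # v" for u b v
    proof (cases "piling u (fst b) = []")
      case False
      then show ?thesis using red[OF split] by (simp add: tops_def)
    next
      case True
      \<comment> \<open>The letters of \<open>c\<close> are central and \<open>a\<close> belongs to
        \<open>x\<close>, so \<open>y\<close> can occur only after \<open>a\<close>, which has left
        a bead on its stack.\<close>
      have "fst b \<noteq> y"
      proof
        assume fst_b: "fst b = y"
        have "beads d y = []" if "d \<in> set u" for d
          using True fst_b that by (simp add: piling_def)
        moreover have "beads a y \<noteq> []" using y yx xe by (simp add: beads_def)
        ultimately have "a \<notin> set u" by blast
        moreover have "b \<notin> insert a (set c)" using fst_b c yc xe y by (auto simp: letters_def)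
        ultimately show False using split w
          by (auto simp: append_eq_append_conv2 append_eq_Cons_conv Cons_eq_append_conv)
      qed
      then show ?thesis using True by (auto simp: tops_def beads_def)
    qed
    then have "foldl act (beads (y, f)) w = (\<lambda>x. piling w x @ beads (y, f) x)"
      by (rule run_without_pop)
    moreover have "act (piling []) (y, f) = beads (y, f)"
      by (simp add: act_def tops_def push_def fun_eq_iff)
    ultimately show ?thesis using y by (simp add: beads_def)
  qed
  moreover have "[(y, f)] @ w \<approx> w @ [(y, f)]"
    using comm y(1) by (simp add: commuting_def letters_iff del: append_Cons)
  from run_weq[OF this reduced_Nil]
  have "foldl act (piling []) ((y, f) # w) = foldl act (piling []) (w @ [(y, f)])" by simp
  ultimately have eq: "None # piling w x = piling w x @ [None]" by simp
  \<comment> \<open>Central letters put nothing on the stack of \<open>x\<close>, so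
    \<open>Some e\<close> is its bottom entry in \<open>piling w\<close>, which contradicts
    \<open>eq\<close>.\<close>
  have "beads d x = []" if "d \<in> set c" for d
  proof -
    have "fst d \<in> central_verts" using c that by (simp add: letters_iff)
    then have "x \<noteq> fst d" "(fst d, x) \<in> parcs G" using x central_verts_adj by auto
    then show ?thesis using arcs_symmetric by (simp add: beads_def)
  qed
  then have "piling c x = []" by (simp add: piling_def)
  then have "piling w x = piling t x @ [Some e]"
    using w xe by (simp add: piling_append piling_Cons beads_def)
  with eq have "last (None # piling t x @ [Some e]) = last (piling t x @ [Some e, None])" by simp
  then show False by simp
qed

lemma commuting_letter_iff:
  assumes "a \<in> letters (pverts G)"
  shows "commuting [a] \<longleftrightarrow> a \<in> letters central_verts"
  using geodesic_commuting_central_letters[OF geodesic_letter[OF assms]]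
    commuting_if_central_letters[of "[a]"] by auto

section \<open>The language of UConj-geodesics\<close>

lemma word_eval_raag:
  "w \<in> words \<Longrightarrow> word_eval (raag G) (raag_gen G) w = word_cong (pverts G) (raag_relations G) `` {w}"
  unfolding raag_def raag_gen_def by (rule word_eval_presented)

lemma word_eval_eq_iff:
  assumes "u \<in> words" "w \<in> words"
  shows "word_eval (raag G) (raag_gen G) u = word_eval (raag G) (raag_gen G) w \<longleftrightarrow> u \<approx> w"
  unfolding word_eval_raag[OF assms(1)] word_eval_raag[OF assms(2)]
  using equiv_word_cong assms by (rule eq_equiv_class_iff)

lemma Geo_iff_geodesic: "w \<in> Geo (raag G) (raag_gen G) (pverts G) \<longleftrightarrow> geodesic w"
proof (cases "w \<in> words")
  case True
  then show ?thesis
    unfolding Geo_def geodesic_def using word_eval_eq_iff[OF _ True] weq_words(1) by blast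
qed (simp add: Geo_def geodesic_def)

text \<open>An element lies in its own class, so a second member exists iff some group element fails
  to commute with it; every group element is the value of a word.\<close>

lemma noncentral_iff:
  assumes w: "w \<in> words"
  defines "g \<equiv> word_eval (raag G) (raag_gen G) w"
  shows "(\<exists>a \<in> conjugacy_class (raag G) g. \<exists>b \<in> conjugacy_class (raag G) g. a \<noteq> b) \<longleftrightarrow> \<not> commuting w"
proof -
  let ?A = "raag G" and ?ev = "word_eval (raag G) (raag_gen G)"
  interpret A: group "raag G" unfolding raag_def by (rule group_presented_group)
  have ev: "?ev u \<in> carrier ?A" if "u \<in> words" for u
    unfolding word_eval_raag[OF that] unfolding raag_def using that by (rule carrier_presentedI)
  have ev_ex: "\<exists>u \<in> words. k = ?ev u" if k: "k \<in> carrier ?A" for k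
  proof -
    obtain u where "u \<in> words" "k = word_cong (pverts G) (raag_relations G) `` {u}"
      by (rule carrier_presentedE[OF k[unfolded raag_def]])
    then show ?thesis using word_eval_raag[of u] by (intro bexI[of _ u]) simp_all
  qed
  have g: "g \<in> carrier ?A" unfolding g_def using w by (rule ev)
  have comm: "?ev u \<otimes>\<^bsub>?A\<^esub> g = g \<otimes>\<^bsub>?A\<^esub> ?ev u \<longleftrightarrow> u @ w \<approx> w @ u" if u: "u \<in> words" for u
  proof -
    have uw: "u @ w \<in> words" "w @ u \<in> words" using u w by auto
    have mult: "word_cong (pverts G) (raag_relations G) `` {s} \<otimes>\<^bsub>?A\<^esub> word_cong (pverts G) (raag_relations G) `` {t}
        = word_cong (pverts G) (raag_relations G) `` {s @ t}" if "s \<in> words" "t \<in> words" for s t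
      unfolding raag_def using that by (rule presented_mult)
    have "?ev u \<otimes>\<^bsub>?A\<^esub> g = ?ev (u @ w)" "g \<otimes>\<^bsub>?A\<^esub> ?ev u = ?ev (w @ u)"
      unfolding g_def word_eval_raag[OF u] word_eval_raag[OF w] word_eval_raag[OF uw(1)]
        word_eval_raag[OF uw(2)] by (rule mult[OF u w], rule mult[OF w u])
    then show ?thesis using word_eval_eq_iff[OF uw] by simp
  qed
  have conj: "k \<otimes>\<^bsub>?A\<^esub> g \<otimes>\<^bsub>?A\<^esub> inv\<^bsub>?A\<^esub> k = g \<longleftrightarrow> k \<otimes>\<^bsub>?A\<^esub> g = g \<otimes>\<^bsub>?A\<^esub> k"
    if "k \<in> carrier ?A" for k
  proof -
    have "g = k \<otimes>\<^bsub>?A\<^esub> g \<otimes>\<^bsub>?A\<^esub> inv\<^bsub>?A\<^esub> k \<longleftrightarrow> k \<otimes>\<^bsub>?A\<^esub> g = g \<otimes>\<^bsub>?A\<^esub> k"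
      using that g by (intro A.inv_solve_right) simp_all
    then show ?thesis by metis
  qed
  have class_iff: "a \<in> conjugacy_class ?A g
      \<longleftrightarrow> (\<exists>k \<in> carrier ?A. a = k \<otimes>\<^bsub>?A\<^esub> g \<otimes>\<^bsub>?A\<^esub> inv\<^bsub>?A\<^esub> k)" for a
    using g unfolding conjugacy_class_def orbit_def by auto
  have g_class: "g \<in> conjugacy_class ?A g"
    unfolding class_iff using g by (intro bexI[of _ "\<one>\<^bsub>?A\<^esub>"]) simp_all
  have "(\<exists>a \<in> conjugacy_class ?A g. \<exists>b \<in> conjugacy_class ?A g. a \<noteq> b)
      \<longleftrightarrow> (\<exists>a \<in> conjugacy_class ?A g. a \<noteq> g)"
    using g_class by metis
  also have "\<dots> \<longleftrightarrow> (\<exists>k \<in> carrier ?A. k \<otimes>\<^bsub>?A\<^esub> g \<noteq> g \<otimes>\<^bsub>?A\<^esub> k)"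
    unfolding Bex_def class_iff using conj by metis
  also have "\<dots> \<longleftrightarrow> (\<exists>u \<in> words. \<not> u @ w \<approx> w @ u)"
  proof
    assume "\<exists>k \<in> carrier ?A. k \<otimes>\<^bsub>?A\<^esub> g \<noteq> g \<otimes>\<^bsub>?A\<^esub> k"
    then obtain k where k: "k \<in> carrier ?A" "k \<otimes>\<^bsub>?A\<^esub> g \<noteq> g \<otimes>\<^bsub>?A\<^esub> k" ..
    from ev_ex[OF k(1)] obtain u where "u \<in> words" "k = ?ev u" ..
    then show "\<exists>u \<in> words. \<not> u @ w \<approx> w @ u" using k(2) comm[of u] by (intro bexI[of _ u]) simp_all
  next
    assume "\<exists>u \<in> words. \<not> u @ w \<approx> w @ u"
    then obtain u where u: "u \<in> words" "\<not> u @ w \<approx> w @ u" ..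
    show "\<exists>k \<in> carrier ?A. k \<otimes>\<^bsub>?A\<^esub> g \<noteq> g \<otimes>\<^bsub>?A\<^esub> k"
      using u(2) unfolding comm[OF u(1), symmetric] by (rule bexI) (rule ev[OF u(1)])
  qed
  finally show ?thesis by (simp add: commuting_def)
qed

lemma UConj_word_eval_iff:
  assumes "u \<in> words" "w \<in> words"
  shows "(word_eval (raag G) (raag_gen G) u, word_eval (raag G) (raag_gen G) w) \<in> UConj (raag G)
    \<longleftrightarrow> u \<approx> w \<or> \<not> commuting u \<and> \<not> commuting w"
proof -
  have "word_eval (raag G) (raag_gen G) v \<in> carrier (raag G)" if "v \<in> words" for v
    unfolding word_eval_raag[OF that] unfolding raag_def using that by (rule carrier_presentedI)
  then show ?thesis
    using assms by (simp add: UConj_def noncentral_iff word_eval_eq_iff del: in_lists_conv_set)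
qed

text \<open>A central element is alone in its \<open>UConj\<close> class, so all its geodesics
  qualify. The noncentral elements share one class, whose minimal length is one whenever it is
  nonempty.\<close>

lemma UConjGeo_eq:
  "UConjGeo (raag G) (raag_gen G) (pverts G)
   = {w \<in> words. \<forall>as \<in> (\<lambda>a. [a]) ` letters (pverts G - central_verts)
                     \<union> (\<lambda>a. [a, flip a]) ` letters central_verts. \<not> subseq as w}
     \<union> {[a] | a. a \<in> letters (pverts G - central_verts)}"
  (is "?U = ?L \<union> ?S")
proof -
  \<comment> \<open>Words for the same element are never shorter than the geodesic \<open>w\<close>,
    so only other noncentral geodesics impose a condition.\<close>
  have U: "w \<in> ?U \<longleftrightarrow> geodesic w
      \<and> (\<not> commuting w \<longrightarrow> (\<forall>u. geodesic u \<and> \<not> commuting u \<longrightarrow> length w \<le> length u))" for w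
  proof (cases "geodesic w")
    case True
    have UC: "(word_eval (raag G) (raag_gen G) w, word_eval (raag G) (raag_gen G) u) \<in> UConj (raag G)
        \<longleftrightarrow> w \<approx> u \<or> \<not> commuting w \<and> \<not> commuting u" if "geodesic u" for u
      using True that by (intro UConj_word_eval_iff) (simp_all add: geodesic_def)
    have "length w \<le> length u" if "w \<approx> u" for u
      using True word_cong.sym[OF that] by (simp add: geodesic_def)
    then show ?thesis using True UC by (auto simp: UConjGeo_def Geo_iff_geodesic)
  qed (simp add: UConjGeo_def Geo_iff_geodesic)
  have sub: "letters (pverts G - central_verts) = letters (pverts G) - letters central_verts"
    by (auto simp: letters_iff)
  have L: "w \<in> ?L \<longleftrightarrow> geodesic w \<and> w \<in> lists (letters central_verts)" for w
  proof
    assume wL: "w \<in> ?L"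
    then have w: "w \<in> words" by blast
    have singles: "\<not> subseq [a] w" if "a \<in> letters (pverts G) - letters central_verts" for a
      using wL that unfolding sub by blast
    have pairs: "\<not> subseq [a, flip a] w" if "a \<in> letters central_verts" for a
      using wL that by blast
    have central: "a \<in> letters central_verts" if "a \<in> set w" for a
      using singles[of a] w that by (auto simp: subseq_singleton_left)
    \<comment> \<open>The pair patterns for both \<open>a\<close> and \<open>flip a\<close> exclude
      the two possible orders.\<close>
    have "flip a \<notin> set w" if "a \<in> set w" for a
      using subseq_pair[of a w "flip a"] pairs[of a] pairs[of "flip a"] central that by auto
    then show "geodesic w \<and> w \<in> lists (letters central_verts)"
      using geodesic_if_no_inverse_letters[OF w] central by auto
  next
    assume w: "geodesic w \<and> w \<in> lists (letters central_verts)"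
    have "\<not> subseq [a, flip a] w" if "a \<in> letters central_verts" for a
      using geodesic_central_no_inverse_letters[of w a] w that list_emb_set[of "(=)" "[a, flip a]" w a]
      by auto
    moreover have "\<not> subseq [a] w" if "a \<in> letters (pverts G) - letters central_verts" for a
      using w that by (auto simp: subseq_singleton_left)
    ultimately show "w \<in> ?L" using w unfolding sub geodesic_def by blast
  qed
  show ?thesis
  proof (intro equalityI subsetI)
    fix w assume "w \<in> ?U"
    then have geo: "geodesic w"
      and min: "\<not> commuting w \<Longrightarrow> geodesic u \<Longrightarrow> \<not> commuting u \<Longrightarrow> length w \<le> length u" for u
      unfolding U by simp_all
    show "w \<in> ?L \<union> ?S"
    proof (cases "commuting w")
      case True
      then have "w \<in> ?L" unfolding L using geo geodesic_commuting_central_letters by simp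
      then show ?thesis ..
    next
      case False
      then have "w \<notin> lists (letters central_verts)" using commuting_if_central_letters by blast
      then obtain a where a: "a \<in> set w" "a \<notin> letters central_verts" by auto
      have aX: "a \<in> letters (pverts G)" using geo a(1) by (auto simp: geodesic_def)
      \<comment> \<open>The noncentral letter of \<open>w\<close> itself is a competitor of length
        one.\<close>
      have "length w \<le> length [a]"
        using False geodesic_letter[OF aX] by (rule min) (simp add: commuting_letter_iff[OF aX] a(2))
      then have "w = [a]" using a(1) by (cases w) auto
      moreover have "a \<in> letters (pverts G - central_verts)" unfolding sub using a(2) aX by blast
      ultimately show ?thesis by blast
    qed
  next
    fix w assume "w \<in> ?L \<union> ?S"
    then show "w \<in> ?U"
    proof
      assume "w \<in> ?L"
      then show ?thesis unfolding L U using commuting_if_central_letters by simp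
    next
      assume "w \<in> ?S"
      then obtain a where a: "w = [a]" "a \<in> letters (pverts G)" unfolding sub by blast
      \<comment> \<open>The empty word is central, so a noncentral word has length at least
        one.\<close>
      have "length w \<le> length u" if "\<not> commuting u" for u
        using that commuting_if_central_letters[of "[]"] a(1) by (cases u) auto
      then show ?thesis unfolding U using geodesic_letter[OF a(2)] a(1) by simp
    qed
  qed
qed

end

theorem theorem5p4:
  fixes \<Gamma> :: "'a pair_pre_digraph"
  assumes "pair_graph \<Gamma>"
  shows "piecewise_testable (letters (pverts \<Gamma>))
           (UConjGeo (raag \<Gamma>) (raag_gen \<Gamma>) (pverts \<Gamma>))"
proof -
  interpret pair_graph \<Gamma> by fact
  have fin: "finite (letters (pverts \<Gamma>))" by (simp add: letters_def)
  have sub: "letters (pverts \<Gamma> - central_verts) \<subseteq> letters (pverts \<Gamma>)"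
    by (auto simp: letters_iff)
  show ?thesis
    unfolding UConjGeo_eq
  proof (rule piecewise_testable.union)
    let ?F = "(\<lambda>a. [a]) ` letters (pverts \<Gamma> - central_verts) \<union> (\<lambda>a. [a, flip a]) ` letters central_verts"
    have "finite ?F"
      using finite_subset[OF sub fin] finite_subset[OF central_letters_subset fin] by simp
    moreover have "?F \<subseteq> lists (letters (pverts \<Gamma>))"
      using subsetD[OF central_letters_subset] subsetD[OF sub]
      by (intro Un_least image_subsetI) simp_all
    ultimately show "piecewise_testable (letters (pverts \<Gamma>))
        {w \<in> lists (letters (pverts \<Gamma>)). \<forall>as \<in> ?F. \<not> subseq as w}"
      by (rule piecewise_testable_avoiding)
    show "piecewise_testable (letters (pverts \<Gamma>)) {[a] | a. a \<in> letters (pverts \<Gamma> - central_verts)}"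
      using fin sub by (rule piecewise_testable_singletons)
  qed
qed

end
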